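(* Let $O$ be a locally finite totally ordered set. For $A\in\mathscr E_O$ let $f(A)=\operatorname{crit}(A)$, and for an antichain $S$ of the poset $(\mathscr I^\infty_O,\subseteq)$ let $g(S)=\bigwedge_{I\in S}\widetilde I$ (meet computed in $\mathscr E_O$). Then $f$ and $g$ are mutually inverse order isomorphisms between $\mathscr E_O$ and $\mathscr A(\mathscr I^\infty_O,\subseteq)^{\mathrm{op}}$.
   Context: $O=(O,\sqsubseteq)$ is a totally ordered set that is locally finite (every $[x..y]=\{z: x\sqsubseteq z\sqsubseteq y\}$ is finite). An interval of $O$ is a subset $I\subseteq O$ such that $x\sqsubseteq z\sqsubseteq y$ with $x,y\in I$ implies $z\in I$ (the empty set is an interval). $\mathscr I_O$ denotes the set of finite intervals of $O$ (including $\emptyset$) and $\mathscr I^\infty_O$ the set of all (finite or infinite) intervals. $\mathscr E_O$ is the set of antichains (with respect to inclusion) of elements of $\mathscr I_O$, partially ordered by $A\le B$ iff for every $I\in A$ there is $J\in B$ with $J\subseteq I$; it is a lattice. For $I\in\mathscr I^\infty_O$, $\widetilde I=\{\{x\}: x\in O\setminus I\}\in\mathscr E_O$. For $A\in\mathscr E_O$, an interval $I\in\mathscr I^\infty_O$ is critical for $A$ if $I$ contains no interval of $A$ and $I$ is maximal under inclusion among the intervals of $\mathscr I^\infty_O$ containing no interval of $A$; $\operatorname{crit}(A)$ is the set of critical intervals of $A$ (an antichain of $(\mathscr I^\infty_O,\subseteq)$). $\mathscr A(\mathscr I^\infty_O,\subseteq)^{\mathrm{op}}$ is the set of antichains (under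 inclusion) of elements of $\mathscr I^\infty_O$, with order $S\le T$ iff for every $I\in T$ there is $J\in S$ with $I\subseteq J$. *)

theory Defs
  imports "HOL-Algebra.Lattice"
begin

definition locally_finite :: "('a, 'm) gorder_scheme \<Rightarrow> bool" where
  "locally_finite L \<longleftrightarrow> (\<forall>x\<in>carrier L. \<forall>y\<in>carrier L. finite (\<lbrace>x..y\<rbrace>\<^bsub>L\<^esub>))"

definition intervals :: "('a, 'm) gorder_scheme \<Rightarrow> 'a set set" where
  "intervals L = {I. I \<subseteq> carrier L \<and>
     (\<forall>x\<in>I. \<forall>y\<in>I. \<forall>z\<in>carrier L. x \<sqsubseteq>\<^bsub>L\<^esub> z \<and> z \<sqsubseteq>\<^bsub>L\<^esub> y \<longrightarrow> z \<in> I)}"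

definition finite_intervals :: "('a, 'm) gorder_scheme \<Rightarrow> 'a set set" where
  "finite_intervals L = {I \<in> intervals L. finite I}"

definition antichains :: "'a set set \<Rightarrow> 'a set set set" where
  "antichains X = {A. A \<subseteq> X \<and> (\<forall>I\<in>A. \<forall>J\<in>A. I \<subseteq> J \<longrightarrow> I = J)}"

definition interval_antichain_order :: "('a, 'm) gorder_scheme \<Rightarrow> 'a set set gorder" where
  "interval_antichain_order L =
     \<lparr> carrier = antichains (finite_intervals L),
       eq = (=),
       le = (\<lambda>A B. \<forall>I\<in>A. \<exists>J\<in>B. J \<subseteq> I) \<rparr>"

text \<open>The order below is already the opposite of the usual one, in which \<open>S\<close> is below \<open>T\<close>
  iff every member of \<open>S\<close> is contained in a member of \<open>T\<close>.\<close>

definition all_interval_antichain_order_op :: "('a, 'm) gorder_scheme \<Rightarrow> 'a set set gorder" where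
  "all_interval_antichain_order_op L =
     \<lparr> carrier = antichains (intervals L),
       eq = (=),
       le = (\<lambda>S T. \<forall>I\<in>T. \<exists>J\<in>S. I \<subseteq> J) \<rparr>"

definition outside_singletons :: "('a, 'm) gorder_scheme \<Rightarrow> 'a set \<Rightarrow> 'a set set" where
  "outside_singletons L I = {{x} | x. x \<in> carrier L - I}"

definition avoiding_intervals :: "('a, 'm) gorder_scheme \<Rightarrow> 'a set set \<Rightarrow> 'a set set" where
  "avoiding_intervals L A = {I \<in> intervals L. \<not> (\<exists>J\<in>A. J \<subseteq> I)}"

definition crit :: "('a, 'm) gorder_scheme \<Rightarrow> 'a set set \<Rightarrow> 'a set set" where
  "crit L A = {I \<in> avoiding_intervals L A. \<forall>K\<in>avoiding_intervals L A. I \<subseteq> K \<longrightarrow> K = I}"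

definition meet_outside :: "('a, 'm) gorder_scheme \<Rightarrow> 'a set set \<Rightarrow> 'a set set" where
  "meet_outside L S =
     \<Sqinter>\<^bsub>interval_antichain_order L\<^esub> (outside_singletons L ` S)"

text \<open>Since \<open>\<Sqinter>\<close> is a choice among greatest lower bounds, \<open>meet_outside\<close> is meaningful only where
  such a bound exists, and the lower bounds in HOL-Algebra disregard elements outside
  the carrier. The next lemma excludes the latter problem.\<close>

lemma outside_singletons_closed:
  assumes "total_order L"
  shows "outside_singletons L I \<in> carrier (interval_antichain_order L)"
proof -
  interpret total_order L by fact
  show ?thesis
    by (auto simp: outside_singletons_def interval_antichain_order_def antichains_def
        finite_intervals_def intervals_def intro: le_antisym)
qed

end

theory Submission
  imports Defs
begin

text \<open>Both antichains encode the same up-closed family of finite intervals: those containing a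
  member of \<open>A\<close> are those not covered by a critical interval, by Zorn's lemma. Hence \<open>g S\<close>
  consists of the minimal finite intervals not covered by a member of \<open>S\<close>, and \<open>g (f A) = A\<close>.

  The identity \<open>f (g S) = S\<close> is a compactness statement: an interval \<open>K\<close> all of whose finite
  subsets are covered by members of the antichain \<open>S\<close> is itself covered by a member of \<open>S\<close>.
  Fix \<open>p \<in> K\<close>. Among three members of \<open>S\<close> containing \<open>p\<close>, the middle one is bounded on both
  sides, hence finite; and if \<open>I \<in> S\<close> is finite and \<open>w \<in> K - I\<close>, only finitely many members of
  \<open>S\<close> contain \<open>p\<close> and \<open>w\<close>. So one can always reduce to a finite subfamily of \<open>S\<close>, where the
  claim is immediate.\<close>

section \<open>Intervals and unions of chains of intervals\<close>

lemma intervalI: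
  assumes "I \<subseteq> carrier L"
    and "\<And>x y z. \<lbrakk>x \<in> I; y \<in> I; z \<in> carrier L; x \<sqsubseteq>\<^bsub>L\<^esub> z; z \<sqsubseteq>\<^bsub>L\<^esub> y\<rbrakk> \<Longrightarrow> z \<in> I"
  shows "I \<in> intervals L"
  using assms unfolding intervals_def by blast

lemma intervalD:
  "\<lbrakk>I \<in> intervals L; x \<in> I; y \<in> I; z \<in> carrier L; x \<sqsubseteq>\<^bsub>L\<^esub> z; z \<sqsubseteq>\<^bsub>L\<^esub> y\<rbrakk> \<Longrightarrow> z \<in> I"
  unfolding intervals_def by blast

lemma interval_closed: "\<lbrakk>I \<in> intervals L; x \<in> I\<rbrakk> \<Longrightarrow> x \<in> carrier L"
  unfolding intervals_def by blast

lemma finite_intervalsI: "\<lbrakk>I \<in> intervals L; finite I\<rbrakk> \<Longrightarrow> I \<in> finite_intervals L"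
  unfolding finite_intervals_def by blast

lemma finite_intervalsD:
  assumes "I \<in> finite_intervals L"
  shows "I \<in> intervals L" and "finite I"
  using assms unfolding finite_intervals_def by auto

lemma antichains_subset: "A \<in> antichains X \<Longrightarrow> A \<subseteq> X"
  by (simp add: antichains_def)

lemma antichainsD: "\<lbrakk>A \<in> antichains X; I \<in> A; J \<in> A; I \<subseteq> J\<rbrakk> \<Longrightarrow> I = J"
  by (simp add: antichains_def)

text \<open>By induction on \<open>J\<close>: of two members of a chain, the larger contains both
  the old part of \<open>J\<close> and the new point.\<close>

lemma chain_finite_subset_Union:
  assumes "subset.chain X C" and "C \<noteq> {}" and "finite J" and "J \<subseteq> \<Union>C"
  shows "\<exists>M\<in>C. J \<subseteq> M"
  using assms(3,4)
proof (induction J)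
  case empty
  then show ?case using \<open>C \<noteq> {}\<close> by blast
next
  case (insert x J)
  then obtain M N where "M \<in> C" "J \<subseteq> M" "N \<in> C" "x \<in> N" by auto
  moreover from this have "M \<subseteq> N \<or> N \<subseteq> M"
    using assms(1) unfolding subset_chain_def by blast
  ultimately show ?case by blast
qed

text \<open>Convexity tests only two end points at a time, and some member of the chain contains
  both.\<close>

lemma Union_chain_interval:
  assumes "subset.chain (intervals L) C"
  shows "\<Union>C \<in> intervals L"
proof -
  have "z \<in> \<Union>C" if "x \<in> \<Union>C" "y \<in> \<Union>C" "z \<in> carrier L" "x \<sqsubseteq>\<^bsub>L\<^esub> z" "z \<sqsubseteq>\<^bsub>L\<^esub> y" for x y z
  proof -
    have "C \<noteq> {}" using that(1) by blast
    from chain_finite_subset_Union[OF assms this, of "{x, y}"] that(1,2)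
    obtain M where M: "M \<in> C" "x \<in> M" "y \<in> M" by auto
    then have "M \<in> intervals L" using assms unfolding subset_chain_def by blast
    then show ?thesis using intervalD[of M L x y z] M that by blast
  qed
  moreover have "\<Union>C \<subseteq> carrier L"
    using assms unfolding subset_chain_def intervals_def by blast
  ultimately show ?thesis unfolding intervals_def by blast
qed

section \<open>Extension of avoiding intervals to critical ones\<close>

lemma crit_antichain: "crit L A \<in> antichains (intervals L)"
  unfolding crit_def avoiding_intervals_def antichains_def by blast

text \<open>Zorn's lemma applies because the members of \<open>A\<close> are finite: one that lies
  in the union of a nonempty chain already lies in a member of the chain.\<close>

lemma avoiding_interval_le_crit:
  assumes fin: "\<And>J. J \<in> A \<Longrightarrow> finite J" and K: "K \<in> avoiding_intervals L A"
  shows "\<exists>M\<in>crit L A. K \<subseteq> M"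
proof -
  let ?Y = "{M \<in> avoiding_intervals L A. K \<subseteq> M}"
  have "\<Union>C \<in> ?Y" if "C \<noteq> {}" and C: "subset.chain ?Y C" for C
  proof -
    have sub: "C \<subseteq> ?Y" using C unfolding subset_chain_def by blast
    then have "subset.chain (intervals L) C"
      using C unfolding subset_chain_def avoiding_intervals_def by blast
    then have "\<Union>C \<in> intervals L" by (rule Union_chain_interval)
    moreover have "\<not> J \<subseteq> \<Union>C" if "J \<in> A" for J
    proof
      assume "J \<subseteq> \<Union>C"
      from chain_finite_subset_Union[OF C \<open>C \<noteq> {}\<close> fin[OF that] this]
      obtain M where "M \<in> C" "J \<subseteq> M" by blast
      then show False using sub that unfolding avoiding_intervals_def by blast
    qed
    moreover have "K \<subseteq> \<Union>C" using sub \<open>C \<noteq> {}\<close> by blast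
    ultimately show ?thesis unfolding avoiding_intervals_def by blast
  qed
  moreover have "?Y \<noteq> {}" using K by blast
  ultimately have "\<exists>M\<in>?Y. \<forall>N\<in>?Y. M \<subseteq> N \<longrightarrow> N = M"
    by (intro subset_Zorn_nonempty) auto
  then obtain M where M: "M \<in> ?Y" and max: "\<forall>N\<in>?Y. M \<subseteq> N \<longrightarrow> N = M" ..
  \<comment> \<open>Maximality within \<open>?Y\<close> suffices, since an interval that contains
    \<open>M\<close> also contains \<open>K\<close>.\<close>
  have "\<forall>N\<in>avoiding_intervals L A. M \<subseteq> N \<longrightarrow> N = M" using M max by auto
  then have "M \<in> crit L A" using M unfolding crit_def by simp
  then show ?thesis using M by auto
qed

section \<open>Finite intervals not covered by a family\<close>

definition uncovered :: "('a, 'm) gorder_scheme \<Rightarrow> 'a set set \<Rightarrow> 'a set set" where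
  "uncovered L S = {J \<in> finite_intervals L. \<forall>I\<in>S. \<not> J \<subseteq> I}"

definition min_uncovered :: "('a, 'm) gorder_scheme \<Rightarrow> 'a set set \<Rightarrow> 'a set set" where
  "min_uncovered L S = {J \<in> uncovered L S. \<forall>J'\<in>uncovered L S. J' \<subseteq> J \<longrightarrow> J' = J}"

lemma min_uncovered_antichain: "min_uncovered L S \<in> antichains (finite_intervals L)"
  unfolding min_uncovered_def uncovered_def antichains_def by blast

text \<open>A finite \<open>J\<close> has only finitely many subsets, so there is a minimal
  uncovered one among them.\<close>

lemma uncovered_ge_min:
  assumes "J \<in> uncovered L S"
  shows "\<exists>M\<in>min_uncovered L S. M \<subseteq> J"
proof -
  have "finite J" using assms finite_intervalsD(2) unfolding uncovered_def by blast
  then have "finite (Pow J \<inter> uncovered L S)" by simp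
  from finite_has_minimal2[OF this, of J] assms
  obtain M where M: "M \<in> Pow J \<inter> uncovered L S"
    and min: "\<forall>N\<in>Pow J \<inter> uncovered L S. N \<subseteq> M \<longrightarrow> M = N"
    by auto
  have "\<forall>N\<in>uncovered L S. N \<subseteq> M \<longrightarrow> N = M" using M min by auto
  then have "M \<in> min_uncovered L S" using M unfolding min_uncovered_def by simp
  then show ?thesis using M by auto
qed

text \<open>The right-hand side is the up-closure of \<open>A\<close> among the finite intervals. A
  finite interval outside it avoids \<open>A\<close> and hence extends to a critical
  interval.\<close>

lemma uncovered_crit:
  assumes "A \<in> antichains (finite_intervals L)"
  shows "uncovered L (crit L A) = {J \<in> finite_intervals L. \<exists>I\<in>A. I \<subseteq> J}"
proof -
  have "finite I" if "I \<in> A" for I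
    using assms that finite_intervalsD(2) unfolding antichains_def by blast
  then have "\<exists>M\<in>crit L A. J \<subseteq> M" if "J \<in> finite_intervals L" "\<forall>I\<in>A. \<not> I \<subseteq> J" for J
    using that avoiding_interval_le_crit[of A J L] finite_intervalsD(1)[of J L]
    unfolding avoiding_intervals_def by blast
  moreover have "\<not> J \<subseteq> M" if "I \<in> A" "I \<subseteq> J" "M \<in> crit L A" for I J M
    using that unfolding crit_def avoiding_intervals_def by blast
  ultimately have "(\<forall>M\<in>crit L A. \<not> J \<subseteq> M) \<longleftrightarrow> (\<exists>I\<in>A. I \<subseteq> J)"
    if "J \<in> finite_intervals L" for J
    using that by meson
  then show ?thesis unfolding uncovered_def by auto
qed

text \<open>An antichain is the set of minimal elements of its up-closure.\<close>

lemma min_uncovered_crit: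
  assumes "A \<in> antichains (finite_intervals L)"
  shows "min_uncovered L (crit L A) = A"
proof -
  note sub = antichains_subset[OF assms] and anti = antichainsD[OF assms]
  show ?thesis
  proof (intro equalityI subsetI)
    fix J assume J: "J \<in> min_uncovered L (crit L A)"
    then obtain I where I: "I \<in> A" "I \<subseteq> J"
      unfolding min_uncovered_def uncovered_crit[OF assms] by auto
    then have "I = J"
      using J sub unfolding min_uncovered_def uncovered_crit[OF assms] by auto
    then show "J \<in> A" using I by simp
  next
    fix J assume J: "J \<in> A"
    have "K = J" if "K \<subseteq> J" "I \<in> A" "I \<subseteq> K" for I K
      using anti[OF \<open>I \<in> A\<close> J] that by auto
    then show "J \<in> min_uncovered L (crit L A)"
      using J sub unfolding min_uncovered_def uncovered_crit[OF assms] by auto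
  qed
qed

section \<open>The two orders and the meet\<close>

lemma partial_order_interval_antichain_order: "partial_order (interval_antichain_order L)"
proof unfold_locales
  let ?E = "interval_antichain_order L"
  \<comment> \<open>Passing from \<open>I\<close> in \<open>A\<close> to \<open>B\<close> and back
    gives \<open>I' \<subseteq> J \<subseteq> I\<close> with \<open>I'\<close> in \<open>A\<close>;
    the antichain property collapses this to \<open>J = I\<close>.\<close>
  have anti: "A \<subseteq> B"
    if A: "A \<in> carrier ?E" "A \<sqsubseteq>\<^bsub>?E\<^esub> B" and B: "B \<sqsubseteq>\<^bsub>?E\<^esub> A" for A B
  proof
    fix I assume "I \<in> A"
    then obtain J where J: "J \<in> B" "J \<subseteq> I"
      using A unfolding interval_antichain_order_def by auto
    then obtain I' where "I' \<in> A" "I' \<subseteq> J"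
      using B unfolding interval_antichain_order_def by auto
    moreover from this have "I' = I"
      using A(1) \<open>I \<in> A\<close> J unfolding interval_antichain_order_def antichains_def by auto
    ultimately show "I \<in> B" using J by auto
  qed
  show "x .=\<^bsub>?E\<^esub> y" if "x \<sqsubseteq>\<^bsub>?E\<^esub> y" "y \<sqsubseteq>\<^bsub>?E\<^esub> x" "x \<in> carrier ?E" "y \<in> carrier ?E" for x y
    using anti[of x y] anti[of y x] that by (simp add: interval_antichain_order_def)
  show "x \<sqsubseteq>\<^bsub>?E\<^esub> z"
    if "x \<sqsubseteq>\<^bsub>?E\<^esub> y" "y \<sqsubseteq>\<^bsub>?E\<^esub> z" "x \<in> carrier ?E" "y \<in> carrier ?E" "z \<in> carrier ?E" for x y z
    using that(1,2) unfolding interval_antichain_order_def by simp (meson order_trans)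
qed (auto simp: interval_antichain_order_def)

lemma partial_order_all_interval_antichain_order_op:
  "partial_order (all_interval_antichain_order_op L)"
proof unfold_locales
  let ?T = "all_interval_antichain_order_op L"
  have anti: "B \<subseteq> A"
    if B: "B \<in> carrier ?T" "A \<sqsubseteq>\<^bsub>?T\<^esub> B" and A: "B \<sqsubseteq>\<^bsub>?T\<^esub> A" for A B
  proof
    fix I assume "I \<in> B"
    then obtain J where J: "J \<in> A" "I \<subseteq> J"
      using B unfolding all_interval_antichain_order_op_def by auto
    then obtain I' where "I' \<in> B" "J \<subseteq> I'"
      using A unfolding all_interval_antichain_order_op_def by auto
    moreover from this have "I = I'"
      using B(1) \<open>I \<in> B\<close> J unfolding all_interval_antichain_order_op_def antichains_def by auto
    ultimately show "I \<in> A" using J by auto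
  qed
  show "x .=\<^bsub>?T\<^esub> y" if "x \<sqsubseteq>\<^bsub>?T\<^esub> y" "y \<sqsubseteq>\<^bsub>?T\<^esub> x" "x \<in> carrier ?T" "y \<in> carrier ?T" for x y
    using anti[of x y] anti[of y x] that by (simp add: all_interval_antichain_order_op_def)
  show "x \<sqsubseteq>\<^bsub>?T\<^esub> z"
    if "x \<sqsubseteq>\<^bsub>?T\<^esub> y" "y \<sqsubseteq>\<^bsub>?T\<^esub> z" "x \<in> carrier ?T" "y \<in> carrier ?T" "z \<in> carrier ?T" for x y z
    using that(1,2) unfolding all_interval_antichain_order_op_def by simp (meson order_trans)
qed (auto simp: all_interval_antichain_order_op_def)

text \<open>A singleton of \<open>outside_singletons L I\<close> below \<open>J\<close> is a point
  of \<open>J\<close> outside \<open>I\<close>; conversely every such point gives one, as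
  \<open>J\<close> lies in the carrier.\<close>

lemma le_outside_singletons_iff:
  assumes "A \<in> antichains (finite_intervals L)"
  shows "A \<sqsubseteq>\<^bsub>interval_antichain_order L\<^esub> outside_singletons L I \<longleftrightarrow> (\<forall>J\<in>A. \<not> J \<subseteq> I)"
proof -
  have "J \<subseteq> carrier L" if "J \<in> A" for J
    using antichains_subset[OF assms] that unfolding finite_intervals_def intervals_def by auto
  then have "(\<exists>K\<in>outside_singletons L I. K \<subseteq> J) \<longleftrightarrow> \<not> J \<subseteq> I" if "J \<in> A" for J
    using that unfolding outside_singletons_def by auto
  then show ?thesis by (simp add: interval_antichain_order_def)
qed

text \<open>The lower bounds are exactly the antichains inside \<open>uncovered L S\<close>, and
  every uncovered interval contains a minimal one. For empty \<open>S\<close> the meet is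
  \<open>{{}}\<close>, the top element.\<close>

lemma is_glb_min_uncovered:
  assumes "total_order L"
  shows "is_glb (interval_antichain_order L) (min_uncovered L S) (outside_singletons L ` S)"
proof -
  let ?E = "interval_antichain_order L"
  have carrier: "carrier ?E = antichains (finite_intervals L)"
    by (simp add: interval_antichain_order_def)
  have lower: "A \<in> Lower ?E (outside_singletons L ` S) \<longleftrightarrow>
      A \<in> antichains (finite_intervals L) \<and> A \<subseteq> uncovered L S" for A
  proof -
    have "A \<in> Lower ?E (outside_singletons L ` S) \<longleftrightarrow>
        A \<in> carrier ?E \<and> (\<forall>I\<in>S. A \<sqsubseteq>\<^bsub>?E\<^esub> outside_singletons L I)"
      using outside_singletons_closed[OF assms] unfolding Lower_def by auto
    also have "\<dots> \<longleftrightarrow> A \<in> carrier ?E \<and> (\<forall>I\<in>S. \<forall>J\<in>A. \<not> J \<subseteq> I)"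
      using le_outside_singletons_iff[of A L] unfolding carrier by auto
    also have "\<dots> \<longleftrightarrow> A \<in> antichains (finite_intervals L) \<and> A \<subseteq> uncovered L S"
      using antichains_subset[of A] unfolding carrier uncovered_def by auto
    finally show ?thesis .
  qed
  have "A \<sqsubseteq>\<^bsub>?E\<^esub> min_uncovered L S" if "A \<subseteq> uncovered L S" for A
    using that uncovered_ge_min[of _ L S] by (auto simp: interval_antichain_order_def)
  then show ?thesis
    unfolding greatest_def using lower min_uncovered_antichain[of L S]
    by (auto simp: min_uncovered_def Lower_def)
qed

text \<open>Greatest lower bounds in a partial order are unique, which removes the choice hidden in
  the meet.\<close>

lemma meet_outside_eq_min_uncovered:
  assumes "total_order L"
  shows "meet_outside L S = min_uncovered L S"
proof -
  interpret E: partial_order "interval_antichain_order L"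
    by (rule partial_order_interval_antichain_order)
  show ?thesis
    unfolding meet_outside_def inf_def
    using is_glb_min_uncovered[OF assms]
    by (rule some_equality) (rule E.greatest_unique[OF _ is_glb_min_uncovered[OF assms]])
qed

section \<open>Critical intervals preserve and reflect the order\<close>

lemma avoiding_intervals_anti:
  assumes "A \<sqsubseteq>\<^bsub>interval_antichain_order L\<^esub> B"
  shows "avoiding_intervals L B \<subseteq> avoiding_intervals L A"
proof
  fix I assume "I \<in> avoiding_intervals L B"
  with assms show "I \<in> avoiding_intervals L A"
    unfolding interval_antichain_order_def avoiding_intervals_def
    by simp (meson order_trans)
qed

text \<open>If \<open>A\<close> is below \<open>B\<close>, a critical interval of \<open>B\<close>
  avoids \<open>A\<close> and so extends to a critical interval of \<open>A\<close>. Conversely, the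
  hypothesis nests the uncovered families, which are the up-closures of \<open>A\<close> and
  \<open>B\<close>.\<close>

lemma crit_le_iff:
  assumes A: "A \<in> antichains (finite_intervals L)" and B: "B \<in> antichains (finite_intervals L)"
  shows "crit L A \<sqsubseteq>\<^bsub>all_interval_antichain_order_op L\<^esub> crit L B \<longleftrightarrow>
    A \<sqsubseteq>\<^bsub>interval_antichain_order L\<^esub> B"
proof
  assume le: "A \<sqsubseteq>\<^bsub>interval_antichain_order L\<^esub> B"
  have "finite J" if "J \<in> A" for J
    using antichains_subset[OF A] that unfolding finite_intervals_def by auto
  note le_crit = avoiding_interval_le_crit[of A _ L, OF this]
  have "\<exists>J\<in>crit L A. I \<subseteq> J" if "I \<in> crit L B" for I
    using le_crit[of I] subsetD[OF avoiding_intervals_anti[OF le], of I] that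
    unfolding crit_def[of L B] by simp
  then show "crit L A \<sqsubseteq>\<^bsub>all_interval_antichain_order_op L\<^esub> crit L B"
    by (simp add: all_interval_antichain_order_op_def)
next
  assume le: "crit L A \<sqsubseteq>\<^bsub>all_interval_antichain_order_op L\<^esub> crit L B"
  have "J \<in> uncovered L (crit L B)" if "J \<in> uncovered L (crit L A)" for J
    using le that unfolding all_interval_antichain_order_op_def uncovered_def
    by simp (meson order_trans)
  moreover have "J \<in> uncovered L (crit L A)" if "J \<in> A" for J
    using antichains_subset[OF A] that unfolding uncovered_crit[OF A] by auto
  ultimately have "\<exists>I\<in>B. I \<subseteq> J" if "J \<in> A" for J
    using that unfolding uncovered_crit[OF B] by simp
  then show "A \<sqsubseteq>\<^bsub>interval_antichain_order L\<^esub> B"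
    by (simp add: interval_antichain_order_def)
qed

section \<open>Local finiteness and finite hulls\<close>

locale locally_finite_total_order = total_order L for L (structure) +
  assumes locally_finite: "locally_finite L"
begin

lemma finite_segment:
  assumes "x \<in> carrier L" and "y \<in> carrier L"
  shows "finite {z \<in> carrier L. x \<sqsubseteq> z \<and> z \<sqsubseteq> y}"
proof -
  have "\<lbrace>x..y\<rbrace> = {z \<in> carrier L. x \<sqsubseteq> z \<and> z \<sqsubseteq> y}"
    unfolding at_least_at_most_def by auto
  then show ?thesis using assms locally_finite unfolding locally_finite_def by metis
qed

text \<open>The convex hull of \<open>F\<close> is the union of the segments between its points, a
  finite union of finite sets.\<close>

lemma finite_hull:
  assumes K: "K \<in> intervals L" and F: "finite F" "F \<subseteq> K"
  shows "\<exists>J\<in>finite_intervals L. F \<subseteq> J \<and> J \<subseteq> K"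
proof
  let ?J = "\<Union>x\<in>F. \<Union>y\<in>F. {z \<in> carrier L. x \<sqsubseteq> z \<and> z \<sqsubseteq> y}"
  have F_carrier: "F \<subseteq> carrier L" using F(2) interval_closed[OF K] by blast
  have "z \<in> ?J" if "u \<in> ?J" "v \<in> ?J" and z: "z \<in> carrier L" "u \<sqsubseteq> z" "z \<sqsubseteq> v" for u v z
  proof -
    obtain x where x: "x \<in> F" "u \<in> carrier L" "x \<sqsubseteq> u" using \<open>u \<in> ?J\<close> by blast
    obtain y where y: "y \<in> F" "v \<in> carrier L" "v \<sqsubseteq> y" using \<open>v \<in> ?J\<close> by blast
    have "x \<sqsubseteq> z" using x z subsetD[OF F_carrier x(1)] le_trans[of x u z] by simp
    moreover have "z \<sqsubseteq> y" using y z subsetD[OF F_carrier y(1)] le_trans[of z v y] by simp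
    ultimately show ?thesis using x y z by blast
  qed
  moreover have "?J \<subseteq> carrier L" by auto
  ultimately have "?J \<in> intervals L" by (intro intervalI)
  moreover have "finite ?J"
    using finite_segment subsetD[OF F_carrier] F(1) by (intro finite_UN_I) simp_all
  ultimately show "?J \<in> finite_intervals L" by (rule finite_intervalsI)
  have "F \<subseteq> ?J"
  proof
    fix x assume "x \<in> F"
    then show "x \<in> ?J" using subsetD[OF F_carrier \<open>x \<in> F\<close>] by (intro UN_I[of x]) simp_all
  qed
  moreover have "?J \<subseteq> K" using intervalD[OF K] subsetD[OF F(2)] by auto
  ultimately show "F \<subseteq> ?J \<and> ?J \<subseteq> K" by blast
qed

section \<open>Antichains of intervals through a common point\<close>

definition below :: "'a \<Rightarrow> 'a set \<Rightarrow> 'a set" where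
  "below p I = {z \<in> I. z \<sqsubseteq> p}"

definition above :: "'a \<Rightarrow> 'a set \<Rightarrow> 'a set" where
  "above p I = {z \<in> I. p \<sqsubseteq> z}"

lemma below_un_above:
  assumes "I \<in> intervals L" and "p \<in> I"
  shows "below p I \<union> above p I = I"
proof -
  have "z \<sqsubseteq> p \<or> p \<sqsubseteq> z" if "z \<in> I" for z
    using total_order_total[OF interval_closed[OF assms(1) that] interval_closed[OF assms]] .
  then show ?thesis unfolding below_def above_def by auto
qed

text \<open>A point outside a convex set lies on one side of all of it, and comparison with the
  single point \<open>p\<close> decides which.\<close>

lemma outside_interval_below:
  assumes I: "I \<in> intervals L" "p \<in> I" "u \<in> I" and z: "z \<in> carrier L" "z \<notin> I" "z \<sqsubseteq> p"
  shows "z \<sqsubseteq> u"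
proof (rule ccontr)
  assume "\<not> z \<sqsubseteq> u"
  then have "u \<sqsubseteq> z" using total_order_total[OF z(1) interval_closed[OF I(1,3)]] by simp
  from intervalD[OF I(1,3,2) z(1) this z(3)] z(2) show False by simp
qed

lemma outside_interval_above:
  assumes I: "I \<in> intervals L" "p \<in> I" "u \<in> I" and z: "z \<in> carrier L" "z \<notin> I" "p \<sqsubseteq> z"
  shows "u \<sqsubseteq> z"
proof (rule ccontr)
  assume "\<not> u \<sqsubseteq> z"
  then have "z \<sqsubseteq> u" using total_order_total[OF z(1) interval_closed[OF I(1,3)]] by simp
  from intervalD[OF I(1,2,3) z(1) z(3) this] z(2) show False by simp
qed

text \<open>The point \<open>x\<close> bounds \<open>I\<close> from above. Hence \<open>y\<close>
  lies below \<open>p\<close>, since otherwise it would lie between \<open>p\<close> and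
  \<open>x\<close> and belong to \<open>J\<close>; so \<open>y\<close> bounds \<open>J\<close> from
  below. Both halves then sit inside finite segments ending at \<open>p\<close>, \<open>x\<close> or
  \<open>y\<close>.\<close>

lemma finite_above_below_of_diff:
  assumes I: "I \<in> intervals L" "p \<in> I" and J: "J \<in> intervals L" "p \<in> J"
    and x: "x \<in> J" "x \<notin> I" "p \<sqsubseteq> x" and y: "y \<in> I" "y \<notin> J"
  shows "finite (above p I) \<and> finite (below p J)"
proof
  have c: "x \<in> carrier L" "y \<in> carrier L" "p \<in> carrier L"
    using interval_closed[OF I(1)] interval_closed[OF J(1)] I(2) x(1) y(1) by simp_all
  have le_x: "z \<sqsubseteq> x" if "z \<in> I" for z
    using outside_interval_above[OF I that c(1) x(2,3)] .
  then have "above p I \<subseteq> {z \<in> carrier L. p \<sqsubseteq> z \<and> z \<sqsubseteq> x}"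
    unfolding above_def using interval_closed[OF I(1)] by auto
  then show "finite (above p I)" by (rule finite_subset) (rule finite_segment[OF c(3,1)])
  have "\<not> p \<sqsubseteq> y" using intervalD[OF J x(1) c(2) _ le_x[OF y(1)]] y(2) by auto
  then have "y \<sqsubseteq> p" using total_order_total[OF c(2,3)] by simp
  then have "y \<sqsubseteq> z" if "z \<in> J" for z
    using outside_interval_below[OF J that c(2) y(2)] by simp
  then have "below p J \<subseteq> {z \<in> carrier L. y \<sqsubseteq> z \<and> z \<sqsubseteq> p}"
    unfolding below_def using interval_closed[OF J(1)] by auto
  then show "finite (below p J)" by (rule finite_subset) (rule finite_segment[OF c(2,3)])
qed

text \<open>Witnesses of the two non-inclusions cannot both lie below \<open>p\<close>: the one
  nearer to \<open>p\<close> would belong to both intervals. The witness above \<open>p\<close>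
  decides which alternative holds.\<close>

lemma finite_halves_of_incomparable:
  assumes I: "I \<in> intervals L" "p \<in> I" and J: "J \<in> intervals L" "p \<in> J"
    and inc: "\<not> I \<subseteq> J" "\<not> J \<subseteq> I"
  shows "finite (above p I) \<and> finite (below p J) \<or> finite (above p J) \<and> finite (below p I)"
proof -
  obtain x y where x: "x \<in> J" "x \<notin> I" and y: "y \<in> I" "y \<notin> J" using inc by blast
  have c: "x \<in> carrier L" "y \<in> carrier L" "p \<in> carrier L"
    using interval_closed[OF I(1)] interval_closed[OF J(1)] I(2) x(1) y(1) by simp_all
  have "p \<sqsubseteq> x \<or> p \<sqsubseteq> y"
  proof (rule ccontr)
    assume "\<not> ?thesis"
    then have le: "x \<sqsubseteq> p" "y \<sqsubseteq> p"
      using total_order_total[OF c(1,3)] total_order_total[OF c(2,3)] by simp_all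
    show False
      using total_order_total[OF c(1,2)] intervalD[OF J(1) x(1) J(2) c(2) _ le(2)]
        intervalD[OF I(1) y(1) I(2) c(1) _ le(1)] x(2) y(2) by auto
  qed
  then show ?thesis
    using finite_above_below_of_diff[OF I J x _ y] finite_above_below_of_diff[OF J I y _ x] by auto
qed

text \<open>Draw an arrow from \<open>i\<close> to \<open>j\<close> when
  \<open>above p (I i)\<close> and \<open>below p (I j)\<close> are finite. Any two of the three
  indices are joined by an arrow, so some index has both an incoming and an outgoing one; its
  interval has two finite halves.\<close>

lemma finite_of_three_incomparable:
  assumes "\<And>i. i < (3::nat) \<Longrightarrow> I i \<in> intervals L \<and> p \<in> I i"
    and "\<And>i j. \<lbrakk>i < 3; j < 3; i \<noteq> j\<rbrakk> \<Longrightarrow> \<not> I i \<subseteq> I j"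
  shows "\<exists>i<3. finite (I i)"
proof -
  have halves: "finite (above p (I i)) \<and> finite (below p (I j)) \<or>
      finite (above p (I j)) \<and> finite (below p (I i))" if "i < 3" "j < 3" "i \<noteq> j" for i j
    using finite_halves_of_incomparable[of "I i" p "I j"] assms(1)[of i] assms(1)[of j]
      assms(2)[of i j] assms(2)[of j i] that by simp
  have whole: "finite (I i)" if "i < 3" "finite (above p (I i))" "finite (below p (I i))" for i
    using below_un_above[of "I i" p] assms(1)[of i] that by (metis finite_Un)
  have "finite (I 0) \<or> finite (I 1) \<or> finite (I 2)"
    using halves[of 0 1] halves[of 1 2] halves[of 0 2] whole[of 0] whole[of 1] whole[of 2]
    by force
  moreover have "0 < (3::nat)" "1 < (3::nat)" "2 < (3::nat)" by simp_all
  ultimately show ?thesis by blast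
qed

text \<open>A member through \<open>p\<close> and \<open>w\<close> is determined by its trace on
  \<open>I\<close>, and the finite set \<open>I\<close> has only finitely many subsets.\<close>

lemma finite_antichain_through:
  assumes S: "S \<in> antichains (intervals L)" and I: "I \<in> S" "finite I" "p \<in> I"
    and w: "w \<in> carrier L" "w \<notin> I"
  shows "finite {J \<in> S. {p, w} \<subseteq> J}"
proof (rule finite_imageD)
  let ?F = "{J \<in> S. {p, w} \<subseteq> J}"
  note anti = antichainsD[OF S] and int = subsetD[OF antichains_subset[OF S]]
  have "(\<lambda>J. I \<inter> J) ` ?F \<subseteq> Pow I" by blast
  then show "finite ((\<lambda>J. I \<inter> J) ` ?F)" using I(2) by (meson finite_Pow_iff finite_subset)
  have pc: "p \<in> carrier L" using interval_closed[OF int[OF I(1)] I(3)] .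
  \<comment> \<open>A member through \<open>p\<close> and \<open>w\<close> must miss a point of \<open>I\<close> on the side opposite to \<open>w\<close>, so on
    that side it stays within \<open>I\<close>.\<close>
  have inside: "z \<in> I"
    if J: "J \<in> ?F" and z: "z \<in> J" and zw: "p \<sqsubseteq> w \<and> z \<sqsubseteq> p \<or> w \<sqsubseteq> p \<and> p \<sqsubseteq> z" for J z
  proof (rule ccontr)
    assume "z \<notin> I"
    have zc: "z \<in> carrier L" and Ji: "J \<in> intervals L"
      using int[of J] interval_closed[of J L z] J z by simp_all
    \<comment> \<open>Both \<open>z\<close> and \<open>w\<close> are in \<open>J\<close> and outside
      \<open>I\<close>, on opposite sides, so \<open>I\<close> lies between them.\<close>
    have "I \<subseteq> J"
    proof
      fix u assume "u \<in> I"
      have uc: "u \<in> carrier L" using interval_closed[OF int[OF I(1)] \<open>u \<in> I\<close>] .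
      have "z \<sqsubseteq> u \<and> u \<sqsubseteq> w \<or> w \<sqsubseteq> u \<and> u \<sqsubseteq> z"
        using zw outside_interval_below[OF int[OF I(1)] I(3) \<open>u \<in> I\<close>]
          outside_interval_above[OF int[OF I(1)] I(3) \<open>u \<in> I\<close>] w zc \<open>z \<notin> I\<close> by auto
      then show "u \<in> J" using intervalD[OF Ji _ _ uc] z J by auto
    qed
    then have "I = J" using anti[OF I(1)] J by simp
    then show False using J w(2) by simp
  qed
  \<comment> \<open>With equal traces, points of difference lie outside \<open>I\<close>, hence by
    \<open>inside\<close> on the same side of \<open>p\<close> as \<open>w\<close>. On one side of
    \<open>p\<close>, convex sets containing \<open>p\<close> are nested.\<close>
  have sub: "A \<subseteq> B \<or> B \<subseteq> A" if A: "A \<in> ?F" and B: "B \<in> ?F" and eq: "I \<inter> A = I \<inter> B" for A B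
  proof (rule ccontr)
    assume "\<not> ?thesis"
    then obtain x y where x: "x \<in> A" "x \<notin> B" and y: "y \<in> B" "y \<notin> A" by blast
    have Ai: "A \<in> intervals L" "p \<in> A" and Bi: "B \<in> intervals L" "p \<in> B"
      using A B int[of A] int[of B] by simp_all
    have xc: "x \<in> carrier L" and yc: "y \<in> carrier L"
      using interval_closed[OF Ai(1) x(1)] interval_closed[OF Bi(1) y(1)] .
    have nI: "x \<notin> I" "y \<notin> I" using eq x y by blast+
    have "p \<sqsubseteq> x \<and> p \<sqsubseteq> y \<or> x \<sqsubseteq> p \<and> y \<sqsubseteq> p"
      using inside[OF A x(1)] inside[OF B y(1)] nI total_order_total[OF pc w(1)]
        total_order_total[OF pc xc] total_order_total[OF pc yc] by argo
    then show False
      using total_order_total[OF xc yc]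
        intervalD[OF Ai x(1) yc] intervalD[OF Ai(1) x(1) Ai(2) yc]
        intervalD[OF Bi y(1) xc] intervalD[OF Bi(1) y(1) Bi(2) xc] x(2) y(2) by argo
  qed
  show "inj_on (\<lambda>J. I \<inter> J) ?F"
  proof (rule inj_onI)
    fix A B assume A: "A \<in> ?F" and B: "B \<in> ?F" and "I \<inter> A = I \<inter> B"
    then show "A = B" using sub[OF A B] anti[of A B] anti[of B A] A B by auto
  qed
qed

section \<open>Compactness of covers by an antichain of intervals\<close>

text \<open>Otherwise pick a point of \<open>K\<close> outside each member that contains
  \<open>P\<close>. These finitely many points together with \<open>P\<close> lie in no member:
  including \<open>P\<close> forces a covering member into the finite subfamily.\<close>

lemma finite_subfamily_covers:
  assumes "finite {I \<in> S. P \<subseteq> I}" and "finite P" "P \<subseteq> K"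
    and cov: "\<And>F. \<lbrakk>finite F; F \<subseteq> K\<rbrakk> \<Longrightarrow> \<exists>I\<in>S. F \<subseteq> I"
  shows "\<exists>I\<in>S. K \<subseteq> I"
proof (rule ccontr)
  assume "\<not> ?thesis"
  then have "\<forall>I\<in>S. \<exists>w. w \<in> K \<and> w \<notin> I" by blast
  then obtain w where w: "\<And>I. I \<in> S \<Longrightarrow> w I \<in> K \<and> w I \<notin> I" by metis
  have "finite (P \<union> w ` {I \<in> S. P \<subseteq> I})" "P \<union> w ` {I \<in> S. P \<subseteq> I} \<subseteq> K"
    using assms(1-3) w by auto
  from cov[OF this] obtain I where "I \<in> S" "P \<subseteq> I" "w ` {I \<in> S. P \<subseteq> I} \<subseteq> I" by blast
  then show False using w[of I] by blast
qed

lemma antichain_covers: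
  assumes S: "S \<in> antichains (intervals L)" and K: "K \<in> intervals L"
    and cov: "\<And>F. \<lbrakk>finite F; F \<subseteq> K\<rbrakk> \<Longrightarrow> \<exists>I\<in>S. F \<subseteq> I"
  shows "\<exists>I\<in>S. K \<subseteq> I"
proof (cases "K = {}")
  case True
  \<comment> \<open>There is no \<open>p\<close> to fix here, but \<open>cov\<close> at the empty
    set shows that \<open>S\<close> is nonempty.\<close>
  then show ?thesis using cov[of "{}"] by auto
next
  case False
  then obtain p where p: "p \<in> K" by blast
  let ?Sp = "{I \<in> S. {p} \<subseteq> I}"
  show ?thesis
  proof (cases "finite ?Sp")
    case True
    then show ?thesis using finite_subfamily_covers[OF _ _ _ cov, of "{p}"] p by auto
  next
    case False
    then obtain B where B: "finite B" "card B = 3" "B \<subseteq> ?Sp"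
      using infinite_arbitrarily_large by blast
    then obtain I where I: "bij_betw I {0..<3::nat} B"
      using ex_bij_betw_nat_finite[of B] by auto
    have mem: "I i \<in> ?Sp" if "i < 3" for i
      using that B(3) bij_betw_apply[OF I, of i] by auto
    have "\<not> I i \<subseteq> I j" if "i < 3" "j < 3" "i \<noteq> j" for i j
    proof
      assume "I i \<subseteq> I j"
      then have "I i = I j"
        using mem[OF that(1)] mem[OF that(2)] antichainsD[OF S] by simp
      then show False using that I unfolding bij_betw_def inj_on_def by auto
    qed
    then have "\<exists>i<3. finite (I i)"
      using mem subsetD[OF antichains_subset[OF S]]
      by (intro finite_of_three_incomparable[of I p]) simp_all
    then obtain J where J: "J \<in> S" "p \<in> J" "finite J" using mem by auto
    show ?thesis
    proof (cases "K \<subseteq> J")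
      case True
      then show ?thesis using J by blast
    next
      case False
      \<comment> \<open>Only finitely many members contain both \<open>p\<close> and
        \<open>w\<close>, so \<open>{p, w}\<close> can replace \<open>{p}\<close> in the reduction
        to a finite subfamily.\<close>
      then obtain w where w: "w \<in> K" "w \<notin> J" by blast
      then have "finite {I \<in> S. {p, w} \<subseteq> I}"
        using finite_antichain_through[OF S J(1,3,2)] interval_closed[OF K] by simp
      then show ?thesis using finite_subfamily_covers[OF _ _ _ cov, of "{p, w}"] p w by auto
    qed
  qed
qed

text \<open>If \<open>K\<close> contains no minimal uncovered interval, it contains no uncovered one
  at all. The finite hull in \<open>K\<close> of any finite subset is then covered, and compactness
  covers \<open>K\<close>.\<close>

lemma avoiding_min_uncovered:
  assumes S: "S \<in> antichains (intervals L)"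
  shows "avoiding_intervals L (min_uncovered L S) = {K \<in> intervals L. \<exists>I\<in>S. K \<subseteq> I}"
proof -
  have "\<exists>I\<in>S. K \<subseteq> I" if K: "K \<in> intervals L" and avoid: "\<forall>J\<in>min_uncovered L S. \<not> J \<subseteq> K" for K
  proof (rule antichain_covers[OF S K])
    fix F assume "finite F" "F \<subseteq> K"
    then obtain J where J: "J \<in> finite_intervals L" "F \<subseteq> J" "J \<subseteq> K" using finite_hull[OF K] by blast
    then have "J \<notin> uncovered L S" using uncovered_ge_min[of J L S] avoid by blast
    then show "\<exists>I\<in>S. F \<subseteq> I" using J unfolding uncovered_def by blast
  qed
  moreover have "\<not> J \<subseteq> K" if "J \<in> min_uncovered L S" "K \<subseteq> I" "I \<in> S" for I J K
    using that unfolding min_uncovered_def uncovered_def by blast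
  ultimately have "(\<forall>J\<in>min_uncovered L S. \<not> J \<subseteq> K) \<longleftrightarrow> (\<exists>I\<in>S. K \<subseteq> I)"
    if "K \<in> intervals L" for K
    using that by meson
  then show ?thesis unfolding avoiding_intervals_def by auto
qed

text \<open>The avoiding intervals form the down-closure of \<open>S\<close>, whose maximal elements
  are the antichain \<open>S\<close> itself.\<close>

lemma crit_min_uncovered:
  assumes "S \<in> antichains (intervals L)"
  shows "crit L (min_uncovered L S) = S"
proof -
  note sub = antichains_subset[OF assms] and anti = antichainsD[OF assms]
  show ?thesis
  proof (intro equalityI subsetI)
    fix K assume K: "K \<in> crit L (min_uncovered L S)"
    then obtain I where I: "I \<in> S" "K \<subseteq> I"
      unfolding crit_def avoiding_min_uncovered[OF assms] by auto
    then have "I = K"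
      using K sub unfolding crit_def avoiding_min_uncovered[OF assms] by auto
    then show "K \<in> S" using I by simp
  next
    fix K assume K: "K \<in> S"
    have "J = K" if "K \<subseteq> J" "I \<in> S" "J \<subseteq> I" for I J
      using anti[OF K \<open>I \<in> S\<close>] that by auto
    then show "K \<in> crit L (min_uncovered L S)"
      using K sub unfolding crit_def avoiding_min_uncovered[OF assms] by auto
  qed
qed

end

text \<open>The \<open>is_glb\<close> clause certifies that the meet defined by choice is a genuine
  one. The inverse identities and the two embeddings together express the order isomorphism.\<close>

theorem theorem21:
  fixes Ord :: "('a, 'm) gorder_scheme"
  assumes "total_order Ord" and "locally_finite Ord"
  shows "let E = interval_antichain_order Ord;
             T = all_interval_antichain_order_op Ord;
             f = crit Ord;
             g = meet_outside Ord
         in (\<forall>S\<in>carrier T. is_glb E (g S) (outside_singletons Ord ` S)) \<and>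
            f \<in> carrier E \<rightarrow> carrier T \<and>
            g \<in> carrier T \<rightarrow> carrier E \<and>
            (\<forall>A\<in>carrier E. g (f A) = A) \<and>
            (\<forall>S\<in>carrier T. f (g S) = S) \<and>
            order_emb E T f \<and>
            order_emb T E g"
proof -
  interpret locally_finite_total_order Ord
    using assms by (simp add: locally_finite_total_order_def locally_finite_total_order_axioms_def)
  let ?E = "interval_antichain_order Ord"
  let ?T = "all_interval_antichain_order_op Ord"
  have carrier: "carrier ?E = antichains (finite_intervals Ord)"
      "carrier ?T = antichains (intervals Ord)"
    by (simp_all add: interval_antichain_order_def all_interval_antichain_order_op_def)
  have g: "meet_outside Ord = min_uncovered Ord"
    using meet_outside_eq_min_uncovered[OF assms(1)] by (rule ext)
  have wpo: "weak_partial_order ?E" "weak_partial_order ?T"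
    using partial_order_interval_antichain_order partial_order_all_interval_antichain_order_op
    by (auto simp: partial_order_def)
  have emb: "order_emb ?E ?T (crit Ord)"
    unfolding order_emb_def carrier using wpo crit_le_iff[of _ Ord] by simp
  \<comment> \<open>The equivalence for \<open>crit\<close> is applied to the images under
    \<open>min_uncovered Ord\<close>, where \<open>crit\<close> returns \<open>S\<close> and
    \<open>S'\<close>.\<close>
  have "min_uncovered Ord S \<sqsubseteq>\<^bsub>?E\<^esub> min_uncovered Ord S' \<longleftrightarrow> S \<sqsubseteq>\<^bsub>?T\<^esub> S'"
    if "S \<in> carrier ?T" "S' \<in> carrier ?T" for S S'
    using crit_le_iff[OF min_uncovered_antichain min_uncovered_antichain, of Ord S S']
      crit_min_uncovered that unfolding carrier by simp
  then have "order_emb ?T ?E (min_uncovered Ord)"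
    unfolding order_emb_def using wpo by simp
  with emb show ?thesis
    using is_glb_min_uncovered[OF assms(1)] crit_antichain[of Ord]
      min_uncovered_antichain[of Ord] min_uncovered_crit[of _ Ord] crit_min_uncovered
    by (simp add: Let_def g carrier Pi_def)
qed

end
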